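(* The five diagonal semi-infinite symmetric matrix $\mathbf{H}$ has the following Cholesky factorization: $$\mathbf{H}=\mathbf{T}\mathbf{T}^\intercal,$$ where $\mathbf{T}$ is the lower triangular semi-infinite matrix with $\bar{\mathbf{s}}^{M,N}=\mathbf{T}\,\bar{\mathbf{p}}^{[2]}$.
   Context: $\mu$ is a positive Borel measure with infinite support contained in an interval $E\subseteq\mathbb{R}$ (bounded or unbounded), with all moments finite; $c\in\mathbb{R}\setminus E$ and $M,N\ge0$. $\{s_n^{M,N}\}_{n\ge0}$ are the polynomials (of degree $n$, positive leading coefficient) orthonormal with respect to $\langle f,g\rangle_S=\int_Efg\,d\mu+Mf(c)g(c)+Nf'(c)g'(c)$. $\{p_n^{[2]}\}_{n\ge0}$ are the polynomials (positive leading coefficients) orthonormal with respect to $\langle f,g\rangle_{[2]}=\int_Ef(x)g(x)(x-c)^2d\mu$. Write $\bar{\mathbf{s}}^{M,N}=[s_0^{M,N},s_1^{M,N},\dots]^\intercal$ and $\bar{\mathbf{p}}^{[2]}=[p_0^{[2]},p_1^{[2]},\dots]^\intercal$. $\mathbf{H}$ is the semi-infinite symmetric five diagonal matrix of multiplication by $(x-c)^2$ in the basis $\{s_n^{M,N}\}$: $(x-c)^2\bar{\mathbf{s}}^{M,N}=\mathbf{H}\,\bar{\mathbf{s}}^{M,N}$, with entries $\mathbf{H}_{n,k}=\langle(x-c)^2s_n^{M,N},s_k^{M,N}\rangle_S$. $\mathbf{T}$ is the lower triangular semi-infinite matrix with positive diagonal entries determined by $\bar{\mathbf{s}}^{M,N}=\mathbf{T}\,\bar{\mathbf{p}}^{[2]}$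 (row $n$ of $\mathbf{T}$ has nonzero entries only in columns $n-2,n-1,n$). *)

theory Defs
  imports
    "HOL-Analysis.Analysis"
    "HOL-Computational_Algebra.Polynomial"
    "HOL-Library.Groups_Big_Fun"
begin

definition measure_support :: "'a::topological_space measure \<Rightarrow> 'a set" where
  "measure_support \<mu> = {x. \<forall>U. open U \<and> x \<in> U \<longrightarrow> emeasure \<mu> U > 0}"

definition sobolev_inner ::
    "real measure \<Rightarrow> real set \<Rightarrow> real \<Rightarrow> real \<Rightarrow> real \<Rightarrow> real poly \<Rightarrow> real poly \<Rightarrow> real" where
  "sobolev_inner \<mu> E c M N f g =
     (LINT x:E|\<mu>. poly f x * poly g x)
       + M * poly f c * poly g c
       + N * poly (pderiv f) c * poly (pderiv g) c"

definition inner2 :: "real measure \<Rightarrow> real set \<Rightarrow> real \<Rightarrow> real poly \<Rightarrow> real poly \<Rightarrow> real" where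
  "inner2 \<mu> E c f g = (LINT x:E|\<mu>. poly f x * poly g x * (x - c)\<^sup>2)"

text \<open>The conditions below determine the sequence \<open>q\<close> uniquely when \<open>B\<close> is an inner product.\<close>

definition orthonormal_polys :: "(real poly \<Rightarrow> real poly \<Rightarrow> real) \<Rightarrow> (nat \<Rightarrow> real poly) \<Rightarrow> bool" where
  "orthonormal_polys B q \<longleftrightarrow>
     (\<forall>n. degree (q n) = n \<and> lead_coeff (q n) > 0) \<and>
     (\<forall>n k. B (q n) (q k) = (if n = k then 1 else 0))"

text \<open>
  Semi-infinite matrices are functions of a row and a column index, both starting at 0.
  \<^const>\<open>Sum_any\<close> is the sum of the nonzero terms if there are finitely many of
  them, and 0 otherwise. In both products below the terms are finitely many as soon as the
  left factor has finitely supported rows, in particular if it is lower triangular or banded.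
\<close>

type_synonym semi_inf_matrix = "nat \<Rightarrow> nat \<Rightarrow> real"

definition smat_mult :: "semi_inf_matrix \<Rightarrow> semi_inf_matrix \<Rightarrow> semi_inf_matrix" where
  "smat_mult A B = (\<lambda>n m. Sum_any (\<lambda>k. A n k * B k m))"

definition smat_poly_vec :: "semi_inf_matrix \<Rightarrow> (nat \<Rightarrow> real poly) \<Rightarrow> (nat \<Rightarrow> real poly)" where
  "smat_poly_vec A q = (\<lambda>n. Sum_any (\<lambda>k. smult (A n k) (q k)))"

definition smat_transpose :: "semi_inf_matrix \<Rightarrow> semi_inf_matrix" where
  "smat_transpose A = (\<lambda>n k. A k n)"

definition lower_triangular :: "semi_inf_matrix \<Rightarrow> bool" where
  "lower_triangular A \<longleftrightarrow> (\<forall>n k. n < k \<longrightarrow> A n k = 0)"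

definition five_diagonal :: "semi_inf_matrix \<Rightarrow> bool" where
  "five_diagonal A \<longleftrightarrow> (\<forall>n k. n + 2 < k \<or> k + 2 < n \<longrightarrow> A n k = 0)"

definition cholesky_factorization :: "semi_inf_matrix \<Rightarrow> semi_inf_matrix \<Rightarrow> bool" where
  "cholesky_factorization A L \<longleftrightarrow>
     lower_triangular L \<and> (\<forall>n. L n n > 0) \<and> A = smat_mult L (smat_transpose L)"

definition mult_matrix ::
    "(real poly \<Rightarrow> real poly \<Rightarrow> real) \<Rightarrow> real poly \<Rightarrow> (nat \<Rightarrow> real poly) \<Rightarrow> semi_inf_matrix" where
  "mult_matrix B h q = (\<lambda>n k. B (h * q n) (q k))"

end

theory Submission
  imports Defs
begin

text \<open>
  Since \<open>(x - c)\<^sup>2\<close> and its derivative vanish at \<open>c\<close>, the point masses do not contribute to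
  \<open>\<langle>(x - c)\<^sup>2 f, g\<rangle>\<close>, which is therefore the inner product of \<open>f\<close> and \<open>g\<close> for the measure
  \<open>(x - c)\<^sup>2 d\<mu>\<close>. So the entries of \<open>H\<close> are the inner products of the \<open>s n\<close> for that measure,
  and Parseval's identity in the orthonormal basis \<open>p\<close> turns them into the entries of \<open>T T\<^sup>t\<close>.
\<close>

locale sym_poly_form =
  fixes B :: "real poly \<Rightarrow> real poly \<Rightarrow> real"
  assumes sym: "B f g = B g f"
    and add_left: "B (f + g) u = B f u + B g u"
    and smult_left: "B (smult a f) u = a * B f u"
begin

lemma sum_left:
  assumes "finite I"
  shows "B (\<Sum>i\<in>I. smult (a i) (f i)) u = (\<Sum>i\<in>I. a i * B (f i) u)"
  using assms
proof induction
  case empty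
  show ?case using smult_left[of 0 0 u] by simp
next
  case (insert i I)
  then show ?case by (simp add: add_left smult_left)
qed

end

lemma degree_basis_expansion:
  fixes q :: "nat \<Rightarrow> 'a :: field poly"
  assumes "\<And>k. degree (q k) = k" and "\<And>k. q k \<noteq> 0" and "degree f \<le> n"
  shows "\<exists>a. f = (\<Sum>k\<le>n. smult (a k) (q k))"
  using assms(3)
proof (induction n arbitrary: f)
  case 0
  have "q 0 \<noteq> 0" "degree (q 0) = 0" using assms by auto
  then obtain b where "q 0 = [:b:]" "b \<noteq> 0" by (metis degree_eq_zeroE pCons_0_0)
  moreover obtain d where "f = [:d:]" using 0 by (metis degree_eq_zeroE le_zero_eq)
  ultimately have "f = (\<Sum>k\<le>0. smult (d / b) (q k))" by simp
  then show ?case by (intro exI[of _ "\<lambda>_. d / b"])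
next
  case (Suc n)
  define b where "b = coeff f (Suc n) / lead_coeff (q (Suc n))"
  have "degree (f - smult b (q (Suc n))) \<le> n"
  proof (rule degree_le, intro allI impI)
    fix i assume "n < i"
    show "coeff (f - smult b (q (Suc n))) i = 0"
    proof (cases "i = Suc n")
      case True
      have "lead_coeff (q (Suc n)) \<noteq> 0" using assms(2) by simp
      then show ?thesis by (simp add: True b_def assms(1))
    next
      case False
      then show ?thesis using \<open>n < i\<close> Suc.prems
        by (simp add: coeff_eq_0 assms(1))
    qed
  qed
  from Suc.IH[OF this] obtain a
    where a: "f - smult b (q (Suc n)) = (\<Sum>k\<le>n. smult (a k) (q k))" by blast
  have "f = (\<Sum>k\<le>Suc n. smult ((a(Suc n := b)) k) (q k))"
    using a by (simp add: algebra_simps)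
  then show ?case by blast
qed

locale orthonormal_poly_form = sym_poly_form +
  fixes q
  assumes orthonormal: "orthonormal_polys B q"
begin

lemma degree_q [simp]: "degree (q n) = n"
  and lead_coeff_q_pos: "lead_coeff (q n) > 0"
  and B_q: "B (q n) (q k) = (if n = k then 1 else 0)"
  using orthonormal unfolding orthonormal_polys_def by blast+

lemma coefficient_eq:
  assumes "f = (\<Sum>k\<le>n. smult (a k) (q k))" and "j \<le> n"
  shows "a j = B f (q j)"
  unfolding assms(1) using assms(2)
  by (simp add: sum_left B_q if_distrib[of "\<lambda>x. _ * x"] cong: if_cong)

lemma expansion:
  assumes "degree f \<le> n"
  shows "f = (\<Sum>k\<le>n. smult (B f (q k)) (q k))"
proof -
  have "q k \<noteq> 0" for k using lead_coeff_q_pos[of k] by auto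
  then obtain a where a: "f = (\<Sum>k\<le>n. smult (a k) (q k))"
    using degree_basis_expansion[OF degree_q _ assms] by blast
  also have "\<dots> = (\<Sum>k\<le>n. smult (B f (q k)) (q k))"
    by (rule sum.cong) (auto simp: coefficient_eq[OF a])
  finally show ?thesis .
qed

lemma orthogonal_lower_degree:
  assumes "degree f < k"
  shows "B f (q k) = 0"
proof -
  have "B f (q k) = B (\<Sum>j\<le>degree f. smult (B f (q j)) (q j)) (q k)"
    by (rule arg_cong[where f = "\<lambda>x. B x (q k)"]) (rule expansion[OF order_refl])
  also have "\<dots> = 0"
    using assms by (simp add: sum_left B_q)
  finally show ?thesis .
qed

lemma parseval:
  assumes "degree f \<le> n"
  shows "B f g = (\<Sum>k\<le>n. B f (q k) * B g (q k))"
proof -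
  have "B f g = B (\<Sum>k\<le>n. smult (B f (q k)) (q k)) g"
    by (rule arg_cong[where f = "\<lambda>x. B x g"]) (rule expansion[OF assms])
  then show ?thesis by (simp add: sum_left sym[of g])
qed

end

lemma smat_poly_vec_banded:
  assumes "\<And>k. m < k \<Longrightarrow> A n k = 0"
  shows "smat_poly_vec A q n = (\<Sum>k\<le>m. smult (A n k) (q k))"
  unfolding smat_poly_vec_def
proof (rule Sum_any.expand_superset)
  show "{k. smult (A n k) (q k) \<noteq> 0} \<subseteq> {..m}"
    using assms by (force simp: not_less[symmetric])
qed simp

lemma smat_mult_banded:
  assumes "\<And>k. m < k \<Longrightarrow> A n k = 0"
  shows "smat_mult A B n j = (\<Sum>k\<le>m. A n k * B k j)"
  unfolding smat_mult_def
proof (rule Sum_any.expand_superset)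
  show "{k. A n k * B k j \<noteq> 0} \<subseteq> {..m}"
    using assms by (force simp: not_less[symmetric])
qed simp

lemma (in orthonormal_poly_form) lower_triangular_connection:
  assumes "\<And>n. degree (s n) = n"
  shows "lower_triangular T \<and> s = smat_poly_vec T q \<longleftrightarrow> T = (\<lambda>n k. B (s n) (q k))"
proof (intro iffI conjI)
  assume *: "lower_triangular T \<and> s = smat_poly_vec T q"
  show "T = (\<lambda>n k. B (s n) (q k))"
  proof (intro ext)
    fix n k
    have T0: "T n k = 0" if "n < k" for k
      using * that by (simp add: lower_triangular_def)
    have "s n = smat_poly_vec T q n" using * by simp
    also have "\<dots> = (\<Sum>k\<le>n. smult (T n k) (q k))"
      by (rule smat_poly_vec_banded) (rule T0)
    finally have "s n = (\<Sum>k\<le>n. smult (T n k) (q k))" .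
    from coefficient_eq[OF this] show "T n k = B (s n) (q k)"
      using T0 by (cases "k \<le> n") (auto simp: orthogonal_lower_degree assms)
  qed
next
  assume T: "T = (\<lambda>n k. B (s n) (q k))"
  show lt: "lower_triangular T"
    by (simp add: T lower_triangular_def orthogonal_lower_degree assms)
  show "s = smat_poly_vec T q"
  proof
    fix n
    have "smat_poly_vec T q n = (\<Sum>k\<le>n. smult (T n k) (q k))"
      by (rule smat_poly_vec_banded) (use lt in \<open>simp add: lower_triangular_def\<close>)
    also have "\<dots> = s n"
      unfolding T by (rule expansion[symmetric]) (simp add: assms)
    finally show "s n = smat_poly_vec T q n" by (rule HOL.sym)
  qed
qed

lemma (in orthonormal_poly_form) cholesky_gram_matrix:
  assumes "\<And>n. degree (s n) = n" and "\<And>n. lead_coeff (s n) > 0"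
  shows "cholesky_factorization (\<lambda>n k. B (s n) (s k)) (\<lambda>n k. B (s n) (q k))"
  unfolding cholesky_factorization_def
proof (intro conjI allI ext)
  show "lower_triangular (\<lambda>n k. B (s n) (q k))"
    by (simp add: lower_triangular_def orthogonal_lower_degree assms)
  show "B (s n) (q n) > 0" for n
  proof -
    have "coeff (s n) n = coeff (\<Sum>k\<le>n. smult (B (s n) (q k)) (q k)) n"
      by (rule arg_cong[where f = "\<lambda>x. coeff x n"]) (rule expansion, simp add: assms(1))
    also have "\<dots> = (\<Sum>k\<le>n. if k = n then B (s n) (q k) * lead_coeff (q n) else 0)"
      unfolding coeff_sum by (rule sum.cong) (auto simp: coeff_eq_0)
    also have "\<dots> = B (s n) (q n) * lead_coeff (q n)" by simp
    finally show ?thesis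
      using assms(2)[of n] lead_coeff_q_pos[of n] by (simp add: assms(1) zero_less_mult_iff)
  qed
  show "B (s n) (s j) =
      smat_mult (\<lambda>n k. B (s n) (q k)) (smat_transpose (\<lambda>n k. B (s n) (q k))) n j" for n j
  proof -
    have "smat_mult (\<lambda>n k. B (s n) (q k)) (smat_transpose (\<lambda>n k. B (s n) (q k))) n j
        = (\<Sum>k\<le>n. B (s n) (q k) * B (s j) (q k))"
      by (subst smat_mult_banded) (auto simp: orthogonal_lower_degree assms smat_transpose_def)
    then show ?thesis using parseval[of "s n" n "s j"] assms(1) by simp
  qed
qed

lemma set_integrable_poly:
  fixes \<mu> :: "real measure"
  assumes "\<And>n::nat. integrable \<mu> (\<lambda>x. x ^ n)" and "E \<in> sets \<mu>"
  shows "set_integrable \<mu> E (\<lambda>x. poly f x)"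
  unfolding set_integrable_def
proof (rule integrable_mult_indicator[OF assms(2)])
  show "integrable \<mu> (\<lambda>x. poly f x)"
    unfolding poly_altdef using assms(1) by simp
qed

lemma set_integral_poly_add:
  fixes \<mu> :: "real measure"
  assumes "\<And>n::nat. integrable \<mu> (\<lambda>x. x ^ n)" and "E \<in> sets \<mu>"
  shows "(LINT x:E|\<mu>. poly (f + g) x) = (LINT x:E|\<mu>. poly f x) + (LINT x:E|\<mu>. poly g x)"
  using set_integral_add(2)[OF set_integrable_poly[OF assms] set_integrable_poly[OF assms]]
  by simp

lemma sobolev_inner_form:
  assumes "\<And>n::nat. integrable \<mu> (\<lambda>x. x ^ n)" and "E \<in> sets \<mu>"
  shows "sym_poly_form (sobolev_inner \<mu> E c M N)"
proof
  fix f g u :: "real poly" and a :: real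
  show "sobolev_inner \<mu> E c M N f g = sobolev_inner \<mu> E c M N g f"
    by (simp add: sobolev_inner_def ac_simps)
  show "sobolev_inner \<mu> E c M N (f + g) u
      = sobolev_inner \<mu> E c M N f u + sobolev_inner \<mu> E c M N g u"
    using set_integral_poly_add[OF assms, of "f * u" "g * u"]
    by (simp add: sobolev_inner_def algebra_simps pderiv_add)
  show "sobolev_inner \<mu> E c M N (smult a f) u = a * sobolev_inner \<mu> E c M N f u"
    by (simp add: sobolev_inner_def algebra_simps pderiv_smult)
qed

lemma sobolev_inner_mult_square:
  "sobolev_inner \<mu> E c M N ([:-c, 1:]\<^sup>2 * f) g = inner2 \<mu> E c f g"
proof -
  define l where "l = [:-c, 1:]"
  have "pderiv l = 1" by (simp add: l_def pderiv_pCons one_pCons)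
  then have "pderiv (l\<^sup>2 * f) = l * (l * pderiv f + 2 * f)"
    by (simp add: power2_eq_square pderiv_mult algebra_simps)
  moreover have "poly l c = 0" by (simp add: l_def)
  ultimately have "poly (pderiv ([:-c, 1:]\<^sup>2 * f)) c = 0"
    unfolding l_def by (simp only: poly_mult mult_zero_left)
  then show ?thesis
    by (simp add: sobolev_inner_def inner2_def poly_power poly_mult ac_simps
        del: mult_pCons_left)
qed

lemma inner2_form:
  assumes "\<And>n::nat. integrable \<mu> (\<lambda>x. x ^ n)" and "E \<in> sets \<mu>"
  shows "sym_poly_form (inner2 \<mu> E c)"
proof -
  interpret S: sym_poly_form "sobolev_inner \<mu> E c 0 0"
    by (rule sobolev_inner_form[OF assms])
  show ?thesis
  proof
    fix f g u :: "real poly" and a :: real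
    show "inner2 \<mu> E c f g = inner2 \<mu> E c g f"
      by (simp add: inner2_def ac_simps)
    show "inner2 \<mu> E c (f + g) u = inner2 \<mu> E c f u + inner2 \<mu> E c g u"
      unfolding sobolev_inner_mult_square[of \<mu> E c 0 0, symmetric]
      by (simp only: distrib_left S.add_left)
    show "inner2 \<mu> E c (smult a f) u = a * inner2 \<mu> E c f u"
      unfolding sobolev_inner_mult_square[of \<mu> E c 0 0, symmetric]
      by (simp only: mult_smult_right S.smult_left)
  qed
qed

theorem proposition6:
  fixes \<mu> :: "real measure" and E :: "real set" and c M N :: real
    and s p :: "nat \<Rightarrow> real poly" and H :: semi_inf_matrix
  assumes "sets \<mu> = sets borel"
    and "is_interval E"
    and "infinite (measure_support \<mu>)" and "measure_support \<mu> \<subseteq> E"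
    and "\<And>n::nat. integrable \<mu> (\<lambda>x. x ^ n)"
    and "c \<notin> E" and "M \<ge> 0" and "N \<ge> 0"
    and "orthonormal_polys (sobolev_inner \<mu> E c M N) s"
    and "orthonormal_polys (inner2 \<mu> E c) p"
    and "H = mult_matrix (sobolev_inner \<mu> E c M N) ([:-c, 1:]\<^sup>2) s"
  shows "(\<lambda>n. [:-c, 1:]\<^sup>2 * s n) = smat_poly_vec H s \<and>
    five_diagonal H \<and> smat_transpose H = H \<and>
    (\<exists>!T. lower_triangular T \<and> s = smat_poly_vec T p) \<and>
    (\<forall>T. lower_triangular T \<and> s = smat_poly_vec T p \<longrightarrow> cholesky_factorization H T)"
proof -
  have E: "E \<in> sets \<mu>"
    using assms(1,2) real_interval_borel_measurable by simp
  interpret S: orthonormal_poly_form "sobolev_inner \<mu> E c M N" s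
    by (intro orthonormal_poly_form.intro sobolev_inner_form orthonormal_poly_form_axioms.intro
        assms E)
  interpret P: orthonormal_poly_form "inner2 \<mu> E c" p
    by (intro orthonormal_poly_form.intro inner2_form orthonormal_poly_form_axioms.intro
        assms E)
  have H: "H = (\<lambda>n k. inner2 \<mu> E c (s n) (s k))"
    by (simp add: assms(11) mult_matrix_def sobolev_inner_mult_square)
  have symm: "smat_transpose H = H"
    unfolding H smat_transpose_def by (intro ext) (rule P.sym)
  have deg: "degree ([:-c, 1:]\<^sup>2 * s n) \<le> n + 2" for n
    using degree_mult_le[of "[:-c, 1:]\<^sup>2" "s n"] by (simp add: degree_power_eq)
  have upper: "H n k = 0" if "n + 2 < k" for n k
    using S.orthogonal_lower_degree[OF le_less_trans[OF deg that]]
    by (simp add: assms(11) mult_matrix_def)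
  have "H n k = 0" if "k + 2 < n" for n k
    using upper[OF that] fun_cong[OF fun_cong[OF symm, of n], of k]
    by (simp add: smat_transpose_def)
  with upper have five: "five_diagonal H"
    by (auto simp: five_diagonal_def)
  have "[:-c, 1:]\<^sup>2 * s n = smat_poly_vec H s n" for n
  proof -
    have "[:-c, 1:]\<^sup>2 * s n = (\<Sum>k\<le>n + 2. smult (H n k) (s k))"
      unfolding assms(11) mult_matrix_def by (rule S.expansion[OF deg])
    also have "\<dots> = smat_poly_vec H s n"
      by (rule smat_poly_vec_banded[OF upper, symmetric])
    finally show ?thesis .
  qed
  moreover have "cholesky_factorization H (\<lambda>n k. inner2 \<mu> E c (s n) (p k))"
    unfolding H by (intro P.cholesky_gram_matrix S.degree_q S.lead_coeff_q_pos)
  ultimately show ?thesis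
    using five symm by (simp add: P.lower_triangular_connection)
qed

end
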